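(* Let $X$ be a finite-dimensional real vector space and let $C, D \subseteq X$ be convex sets. For an oriented affine map $f: X \to (Y, Y_+)$ with $f(D) \le 0 \le f(C)$, consider the conditions (1) $f(D) < f(C)$, i.e. $f(d) < f(c)$ for all $c \in C$, $d \in D$ (so that $f$ certifies $C \cap D = \varnothing$); (2) $\ker f = T_a(C,D)$. Let $\phi_0 : X \to (\{0\},\{0\})$ be the zero map and run the following loop, increasing $m$ at each step, for $m \in \{1, 2, \ldots\}$: - If $\phi_{m-1}$ satisfies (1) or (2), return $\phi_{m-1}$. - Otherwise, let $\phi_m := \phi_{m-1} \rtimes \psi_m$, where $\psi_m : X \to (\mathbb{R}, \mathbb{R}_+)$ is an affine oriented functional that is non-constant on $\ker \phi_{m-1}$ and such that $(\phi_{m-1} \rtimes \psi_m)(D) \le 0 \le (\phi_{m-1} \rtimes \psi_m)(C)$ (such a $\psi_m$ is guaranteed to exist in this case). This process terminates for some $m \le \dim(X)$, yielding an oriented affine map separating $C$ from $D$ that satisfies (1) or (2).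
   Context: A convex cone contains the origin and is closed under addition and under multiplication by positive scalars; $\operatorname{lin}(K) := K \cap (-K)$; $K$ is pointed if $\operatorname{lin}(K) = \{0\}$. An oriented affine map $f: X \to (Y,Y_+)$ is an affine map from $X$ to a real vector space $Y$ equipped with a pointed convex cone $Y_+ \subseteq Y$, which defines the partial order $y \le y' \iff y'-y \in Y_+$; $y < y'$ means $y \le y'$ and $y \ne y'$. Inequalities between sets are elementwise. An oriented affine map $f$ separates $C$ from $D$ if $f(D) \le 0 \le f(C)$. $\ker f := f^{-1}(0)$. $\mathbb{R}_+ = \{t \in \mathbb{R} \mid t \ge 0\}$. Lexicographic product: for oriented affine maps $\phi_1: X \to (Y_1, Y_{1+})$, $\phi_2 : X \to (Y_2, Y_{2+})$, the oriented affine map $\phi_1 \rtimes \phi_2 : X \to (Y_1 \times Y_2, Y_+)$ is $x \mapsto (\phi_1(x), \phi_2(x))$ with $Y_+ := ((Y_{1+} \setminus \{0\}) \times Y_2) \cup (\{0\} \times Y_{2+})$. Joint supporting subspace: $T_a(C,D) := \gamma_1^{-1}(\operatorname{lin}(K-G)) \subseteq X$, where $\gamma_1 : X \to X \times \mathbb{R}$, $\gamma_1(x) = (x,1)$, $K := \operatorname{cone}(C \times \{1\})$, $G := \operatorname{cone}(D \times \{1\})$, $K - G := \{k - g \mid k \in K, g \in G\}$, and $\operatorname{cone}(S) := \{\lambda s \mid \lambda \ge 0, s \in S\}$ (with $\operatorname{cone}(\varnothing)=\{0\}$). It may be empty. *)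

theory Defs
  imports "HOL-Analysis.Analysis" "HOL-Analysis.Finite_Function_Topology"
begin

section \<open>Convex cones\<close>

definition lin :: "'a::real_vector set \<Rightarrow> 'a set" where
  "lin K = K \<inter> uminus ` K"

definition pointed :: "'a::real_vector set \<Rightarrow> bool" where
  "pointed K \<longleftrightarrow> lin K = {0}"

text \<open>The set \<open>cone(S)\<close> of nonnegative multiples of points of \<open>S\<close>, with \<open>cone({}) = {0}\<close>; the
  library's \<open>conic hull {}\<close> is empty, hence the \<open>insert 0\<close> (which changes nothing for nonempty \<open>S\<close>).\<close>

definition gen_cone :: "'a::real_vector set \<Rightarrow> 'a set" where
  "gen_cone S = insert 0 {t *\<^sub>R s | t s. t \<ge> 0 \<and> s \<in> S}"


section \<open>Oriented affine maps\<close>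

definition affine_map :: "('a::real_vector \<Rightarrow> 'b::real_vector) \<Rightarrow> bool" where
  "affine_map f \<longleftrightarrow> (\<forall>x y u v. u + v = 1 \<longrightarrow> f (u *\<^sub>R x + v *\<^sub>R y) = u *\<^sub>R f x + v *\<^sub>R f y)"

text \<open>A map \<open>X \<rightarrow> (Y, Y\<^sub>+)\<close>. The target space \<open>Y\<close> is a linear subspace of the type \<open>'b\<close>, so that
  spaces of different dimensions, including \<open>{0}\<close>, can occur over one type.\<close>

record ('a, 'b) oriented_map =
  omap :: "'a \<Rightarrow> 'b"
  target :: "'b set"
  pos :: "'b set"

definition oriented_affine :: "('a::real_vector, 'b::real_vector) oriented_map \<Rightarrow> bool" where
  "oriented_affine f \<longleftrightarrow>
     subspace (target f) \<and> affine_map (omap f) \<and> range (omap f) \<subseteq> target f \<and>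
     pos f \<subseteq> target f \<and> convex_cone (pos f) \<and> pointed (pos f)"

definition ole :: "('a, 'b::real_vector) oriented_map \<Rightarrow> 'b \<Rightarrow> 'b \<Rightarrow> bool" where
  "ole f y y' \<longleftrightarrow> y' - y \<in> pos f"

definition oless :: "('a, 'b::real_vector) oriented_map \<Rightarrow> 'b \<Rightarrow> 'b \<Rightarrow> bool" where
  "oless f y y' \<longleftrightarrow> ole f y y' \<and> y \<noteq> y'"

definition ker :: "('a, 'b::real_vector) oriented_map \<Rightarrow> 'a set" where
  "ker f = omap f -` {0}"

text \<open>\<open>separates f C D\<close>: \<open>f(D) \<le> 0 \<le> f(C)\<close>.\<close>

definition separates :: "('a, 'b::real_vector) oriented_map \<Rightarrow> 'a set \<Rightarrow> 'a set \<Rightarrow> bool" where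
  "separates f C D \<longleftrightarrow> (\<forall>d\<in>D. ole f (omap f d) 0) \<and> (\<forall>c\<in>C. ole f 0 (omap f c))"

definition certifies_disjoint :: "('a, 'b::real_vector) oriented_map \<Rightarrow> 'a set \<Rightarrow> 'a set \<Rightarrow> bool" where
  "certifies_disjoint f C D \<longleftrightarrow> (\<forall>c\<in>C. \<forall>d\<in>D. oless f (omap f d) (omap f c))"

lemma certifies_disjointD: "certifies_disjoint f C D \<Longrightarrow> C \<inter> D = {}"
  by (auto simp: certifies_disjoint_def oless_def)

definition lex_product ::
  "('a, 'b::real_vector) oriented_map \<Rightarrow> ('a, 'c::real_vector) oriented_map \<Rightarrow> ('a, 'b \<times> 'c) oriented_map"
  (infixl \<open>\<rtimes>\<close> 70) where
  "f \<rtimes> g =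
     \<lparr> omap = (\<lambda>x. (omap f x, omap g x)),
       target = target f \<times> target g,
       pos = (pos f - {0}) \<times> target g \<union> {0} \<times> pos g \<rparr>"

definition oriented_functional :: "('a \<Rightarrow> real) \<Rightarrow> ('a, real) oriented_map" where
  "oriented_functional g = \<lparr> omap = g, target = UNIV, pos = {0..} \<rparr>"


section \<open>The joint supporting subspace\<close>

definition joint_supporting_subspace :: "'a::real_vector set \<Rightarrow> 'a set \<Rightarrow> 'a set" where
  "joint_supporting_subspace C D =
     (let K = gen_cone (C \<times> {1::real}); G = gen_cone (D \<times> {1::real})
      in (\<lambda>x. (x, 1)) -` lin {k - g | k g. k \<in> K \<and> g \<in> G})"


section \<open>The loop\<close>

text \<open>The map \<open>\<phi>\<^sub>m\<close> takes values in the iterated product \<open>(({0} \<times> \<real>) \<times> \<dots>) \<times> \<real>\<close> with \<open>m\<close> factors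
  \<open>\<real>\<close>. These products have different types, so they are realised inside the one space of finitely
  supported sequences, with the scalar added in step \<open>m\<close> stored at index \<open>m\<close>: the target of
  \<open>\<phi>\<^sub>m\<close> is the space of sequences supported in \<open>{1..m}\<close>, and \<open>append_coord m\<close> is an isomorphism from
  the product of the target of \<open>\<phi>\<^sub>m\<^sub>-\<^sub>1\<close> with \<open>\<real>\<close> onto it (lemma \<open>append_coord_iso\<close> below). The cone
  is carried along this isomorphism.\<close>

type_synonym 'a loop_map = "('a, nat \<Rightarrow>\<^sub>0 real) oriented_map"

definition append_coord :: "nat \<Rightarrow> (nat \<Rightarrow>\<^sub>0 real) \<times> real \<Rightarrow> (nat \<Rightarrow>\<^sub>0 real)" where
  "append_coord m = (\<lambda>(y, t). y + Poly_Mapping.single m t)"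

definition transport :: "('b \<Rightarrow> 'c) \<Rightarrow> ('a, 'b) oriented_map \<Rightarrow> ('a, 'c) oriented_map" where
  "transport j f = \<lparr> omap = j \<circ> omap f, target = j ` target f, pos = j ` pos f \<rparr>"

definition initial_map :: "'a loop_map" where
  "initial_map = \<lparr> omap = (\<lambda>_. 0), target = {0}, pos = {0} \<rparr>"

definition finished :: "'a::real_vector set \<Rightarrow> 'a set \<Rightarrow> ('a, 'b::real_vector) oriented_map \<Rightarrow> bool" where
  "finished C D f \<longleftrightarrow> certifies_disjoint f C D \<or> ker f = joint_supporting_subspace C D"

text \<open>\<open>g\<close> may be chosen as the next functional when the current map is \<open>f\<close>.\<close>

definition admissible ::
  "'a::real_vector set \<Rightarrow> 'a set \<Rightarrow> ('a, 'b::real_vector) oriented_map \<Rightarrow> ('a \<Rightarrow> real) \<Rightarrow> bool" where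
  "admissible C D f g \<longleftrightarrow>
     oriented_affine (oriented_functional g) \<and>
     \<not> g constant_on ker f \<and>
     separates (f \<rtimes> oriented_functional g) C D"

text \<open>\<open>loop_step C D m f f'\<close>: the loop passes from \<open>\<phi>\<^sub>m\<^sub>-\<^sub>1 = f\<close> to \<open>\<phi>\<^sub>m = f'\<close>, for some choice of the
  functional \<open>\<psi>\<^sub>m\<close>.\<close>

definition loop_step ::
  "'a::real_vector set \<Rightarrow> 'a set \<Rightarrow> nat \<Rightarrow> 'a loop_map \<Rightarrow> 'a loop_map \<Rightarrow> bool" where
  "loop_step C D m f f' \<longleftrightarrow>
     \<not> finished C D f \<and>
     (\<exists>g. admissible C D f g \<and> f' = transport (append_coord m) (f \<rtimes> oriented_functional g))"

text \<open>\<open>loop_reaches C D m f\<close>: some sequence of choices leads to \<open>\<phi>\<^sub>m = f\<close>.\<close>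

inductive loop_reaches :: "'a::real_vector set \<Rightarrow> 'a set \<Rightarrow> nat \<Rightarrow> 'a loop_map \<Rightarrow> bool"
  for C D where
  start: "loop_reaches C D 0 initial_map"
| step: "loop_reaches C D m f \<Longrightarrow> loop_step C D (Suc m) f f' \<Longrightarrow> loop_reaches C D (Suc m) f'"

text \<open>A run of the loop that goes on until a map is returned. Entries of \<open>\<Phi>\<close> after the first
  finished one carry no meaning.\<close>

definition loop_run :: "'a::real_vector set \<Rightarrow> 'a set \<Rightarrow> (nat \<Rightarrow> 'a loop_map) \<Rightarrow> bool" where
  "loop_run C D \<Phi> \<longleftrightarrow>
     \<Phi> 0 = initial_map \<and>
     (\<forall>m. (\<forall>k\<le>m. \<not> finished C D (\<Phi> k)) \<longrightarrow> loop_step C D (Suc m) (\<Phi> m) (\<Phi> (Suc m)))"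

definition loop_returns :: "'a::real_vector set \<Rightarrow> 'a set \<Rightarrow> (nat \<Rightarrow> 'a loop_map) \<Rightarrow> nat \<Rightarrow> bool" where
  "loop_returns C D \<Phi> m \<longleftrightarrow> finished C D (\<Phi> m) \<and> (\<forall>k<m. \<not> finished C D (\<Phi> k))"

lemma lookup_scaleR: "Poly_Mapping.lookup (r *\<^sub>R y) i = r *\<^sub>R Poly_Mapping.lookup y i"
  by (simp add: scaleR_poly_mapping_def)

lemma linear_append_coord: "linear (append_coord m)"
  by (rule linearI)
    (auto simp: append_coord_def algebra_simps single_add poly_mapping_eq_iff fun_eq_iff
      lookup_add lookup_single when_def lookup_scaleR)

lemma append_coord_image:
  "append_coord (Suc m) ` ({y. Poly_Mapping.keys y \<subseteq> {1..m}} \<times> UNIV) =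
     {y. Poly_Mapping.keys y \<subseteq> {1..Suc m}}"
proof (intro equalityI subsetI)
  fix z assume "z \<in> append_coord (Suc m) ` ({y. Poly_Mapping.keys y \<subseteq> {1..m}} \<times> UNIV)"
  then obtain y t where "Poly_Mapping.keys y \<subseteq> {1..m}" "z = y + Poly_Mapping.single (Suc m) t"
    by (auto simp: append_coord_def)
  then show "z \<in> {y. Poly_Mapping.keys y \<subseteq> {1..Suc m}}"
    using Poly_Mapping.keys_add[of y "Poly_Mapping.single (Suc m) t"]
    by (fastforce split: if_splits)
next
  fix z :: "nat \<Rightarrow>\<^sub>0 real" assume z: "z \<in> {y. Poly_Mapping.keys y \<subseteq> {1..Suc m}}"
  define y where "y = z - Poly_Mapping.single (Suc m) (Poly_Mapping.lookup z (Suc m))"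
  have "i \<in> {1..m}" if "i \<in> Poly_Mapping.keys y" for i
  proof -
    have "i \<noteq> Suc m" "i \<in> Poly_Mapping.keys z"
      using that by (auto simp: y_def in_keys_iff lookup_minus lookup_single when_def split: if_splits)
    then show ?thesis using z by (auto simp: subset_iff le_Suc_eq)
  qed
  moreover have "z = append_coord (Suc m) (y, Poly_Mapping.lookup z (Suc m))"
    by (simp add: append_coord_def y_def)
  ultimately show "z \<in> append_coord (Suc m) ` ({y. Poly_Mapping.keys y \<subseteq> {1..m}} \<times> UNIV)"
    by blast
qed

lemma target_loop_reaches:
  "loop_reaches C D m f \<Longrightarrow> target f = {y. Poly_Mapping.keys y \<subseteq> {1..m}}"
proof (induction rule: loop_reaches.induct)
  case start
  then show ?case by (auto simp: initial_map_def)
next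
  case (step m f f')
  have "target f' = append_coord (Suc m) ` (target f \<times> UNIV)"
    using step.hyps by (auto simp: loop_step_def transport_def lex_product_def oriented_functional_def)
  then show ?case by (simp only: step.IH append_coord_image)
qed

lemma append_coord_iso:
  assumes "loop_reaches C D m f"
  shows "linear (append_coord (Suc m))"
    and "bij_betw (append_coord (Suc m)) (target f \<times> UNIV) {y. Poly_Mapping.keys y \<subseteq> {1..Suc m}}"
proof -
  show "linear (append_coord (Suc m))" by (rule linear_append_coord)
  have key: "Poly_Mapping.lookup y (Suc m) = 0" if "y \<in> target f" for y
    using that target_loop_reaches[OF assms] by (fastforce simp: in_keys_iff)
  have "inj_on (append_coord (Suc m)) (target f \<times> UNIV)"
  proof (rule inj_onI, clarify)
    fix y t y' t' assume y: "y \<in> target f" "y' \<in> target f"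
      and eq: "append_coord (Suc m) (y, t) = append_coord (Suc m) (y', t')"
    have "Poly_Mapping.lookup (append_coord (Suc m) (y, t)) (Suc m) = t"
      "Poly_Mapping.lookup (append_coord (Suc m) (y', t')) (Suc m) = t'"
      using y key by (auto simp: append_coord_def lookup_add)
    then have "t = t'" using eq by simp
    then show "y = y' \<and> t = t'" using eq by (simp add: append_coord_def)
  qed
  then show "bij_betw (append_coord (Suc m)) (target f \<times> UNIV)
      {y. Poly_Mapping.keys y \<subseteq> {1..Suc m}}"
    by (simp only: bij_betw_def append_coord_image target_loop_reaches[OF assms] simp_thms)
qed

end

(* If the current map f does not certify disjointness, its kernel N meets both C and D, because the
   cone of f is pointed. Let P be the cone generated by the differences c - d of points of C and D
   that lie in N; it is contained in the direction space S of N. If P = S, every point of N belongs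
   to T_a(C,D), and N = T_a(C,D) follows. Otherwise P is a proper convex cone in the finite-dimensional
   space S, so some linear functional is nonnegative on P and nonzero on S; shifted by a constant
   it is the next functional. Every step lowers the dimension of the direction space of the kernel,
   hence there are at most dim X steps. *)

theory Submission
  imports Defs
begin

section \<open>Separating a convex cone in finite dimension\<close>

text \<open>A basis \<open>B\<close> of \<open>W\<close> stays independent when \<open>v\<close> is
  added, so the values 0 on \<open>B\<close> and 1 at \<open>v\<close> may be prescribed and
  extended linearly.\<close>

lemma functional_vanishing_on_subspace:
  assumes "subspace W" and "v \<notin> W"
  obtains g :: "'a::real_vector \<Rightarrow> real" where "linear g" "\<And>w. w \<in> W \<Longrightarrow> g w = 0" "g v = 1"
proof -
  obtain B where B: "B \<subseteq> W" "independent B" "W \<subseteq> span B"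
    using real_vector.maximal_independent_subset[of W] by blast
  have "span B \<subseteq> W"
    using B(1) assms(1) by (simp add: span_minimal)
  then have "v \<notin> span B"
    using assms(2) by blast
  then have "independent (insert v B)"
    using B(2) real_vector.independent_insertI by blast
  then obtain g :: "'a \<Rightarrow> real" where g: "linear g" "\<forall>x\<in>insert v B. g x = (if x = v then 1 else 0)"
    using linear_independent_extend[of "insert v B" "\<lambda>x. if x = v then 1 else 0"] by blast
  have "v \<notin> B"
    using \<open>v \<notin> W\<close> B(1) by blast
  then have "\<And>b. b \<in> B \<Longrightarrow> g b = 0"
    using g(2) by auto
  then have "g w = 0" if "w \<in> W" for w
    using linear_eq_0_on_span[OF g(1), of B w] that B(3) by blast
  then show thesis
    using g that by simp
qed

text \<open>This is the M. Riesz extension argument, done algebraically: one generator is added at a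
  time, and its value is chosen between the lower and upper bounds that \<open>P\<close> imposes.
  The order unit \<open>e\<close> keeps both families of bounds nonempty. No closedness of
  \<open>P\<close> enters.\<close>

lemma riesz_extension:
  fixes P :: "'a::real_vector set"
  assumes P: "convex_cone P" and e: "- e \<notin> P" and "finite B"
    and unit: "\<And>x. x \<in> span (insert e B) \<Longrightarrow> \<exists>t\<ge>0. t *\<^sub>R e + x \<in> P"
  shows "\<exists>h :: 'a \<Rightarrow> real. linear h \<and> h e = 1 \<and> (\<forall>x\<in>P \<inter> span (insert e B). h x \<ge> 0)"
  using \<open>finite B\<close> unit
proof (induction B rule: finite_induct)
  case empty
  have "e \<noteq> 0"
    using e P convex_cone_contains_0 by fastforce
  then obtain h :: "'a \<Rightarrow> real" where h: "linear h" "h e = 1"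
    using functional_vanishing_on_subspace[of "{0}" e] by auto
  \<comment> \<open>A negative multiple of \<open>e\<close> in \<open>P\<close> could be rescaled to
    \<open>- e\<close>.\<close>
  have "h x \<ge> 0" if x: "x \<in> P" "x \<in> span {e}" for x
  proof (rule ccontr)
    assume neg: "\<not> h x \<ge> 0"
    obtain t where t: "x = t *\<^sub>R e"
      using x(2) by (auto simp: real_vector.span_singleton)
    then have "t < 0"
      using neg h by (simp add: linear_scale)
    then have "(- 1 / t) *\<^sub>R x \<in> P"
      by (intro convex_cone_scaleR[OF P]) (auto simp: x field_simps)
    then show False
      using e t \<open>t < 0\<close> by simp
  qed
  then show ?case
    using h by auto
next
  case (insert v B)
  define W where "W = span (insert e B)"
  have W: "subspace W"
    by (simp add: W_def)
  have W': "span (insert e (insert v B)) = span (insert v (insert e B))"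
    by (simp add: insert_commute)
  have sub: "W \<subseteq> span (insert e (insert v B))"
    unfolding W_def by (rule span_mono) auto
  obtain h :: "'a \<Rightarrow> real" where h: "linear h" "h e = 1" "\<forall>x\<in>P \<inter> W. h x \<ge> 0"
    using insert.IH insert.prems sub unfolding W_def by blast
  show ?case
  proof (cases "v \<in> W")
    case True
    then have "span (insert e (insert v B)) = W"
      unfolding W' W_def by (rule span_redundant)
    then show ?thesis
      using h by auto
  next
    case False
    obtain g :: "'a \<Rightarrow> real" where g: "linear g" "\<And>w. w \<in> W \<Longrightarrow> g w = 0" "g v = 1"
      using functional_vanishing_on_subspace[OF W False] by blast
    have eW: "t *\<^sub>R e \<in> W" for t
      unfolding W_def by (simp add: span_base span_scale)
    \<comment> \<open>Nonnegativity at a point \<open>v + w\<close> of \<open>P\<close> forces the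
      value at \<open>v\<close> to be at least \<open>- h w\<close>; a point \<open>- v + w\<close>
      of \<open>P\<close> forces it to be at most \<open>h w\<close>. \<open>L\<close> collects the
      lower bounds.\<close>
    define L where "L = {- h w | w. w \<in> W \<and> v + w \<in> P}"
    have vspan: "v \<in> span (insert e (insert v B))"
      by (simp add: span_base)
    have upper: "l \<le> h w" if l: "l \<in> L" and w: "w \<in> W" "- v + w \<in> P" for l w
    proof -
      obtain w' where w': "l = - h w'" "w' \<in> W" "v + w' \<in> P"
        using l by (auto simp: L_def)
      have "(v + w') + (- v + w) \<in> P"
        using P w' w convex_cone_add by blast
      then have "w' + w \<in> P \<inter> W"
        using w w' W subspace_add by (auto simp: algebra_simps)
      then have "h w' + h w \<ge> 0"
        using h by (metis linear_add)
      then show ?thesis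
        using w' by simp
    qed
    obtain t1 where t1: "t1 *\<^sub>R e + v \<in> P"
      using insert.prems[OF vspan] by blast
    obtain t2 where t2: "t2 *\<^sub>R e + - v \<in> P"
      using insert.prems[OF span_neg[OF vspan]] by blast
    have ne: "L \<noteq> {}"
      using t1 eW[of t1] by (auto simp: L_def add.commute)
    have bdd: "bdd_above L"
      using upper[of _ "t2 *\<^sub>R e"] t2 eW by (intro bdd_aboveI) (auto simp: add.commute)
    \<comment> \<open>Since \<open>g\<close> vanishes on \<open>W\<close> and is 1 at
      \<open>v\<close>, the correction keeps \<open>h\<close> on \<open>W\<close> and replaces its
      value at \<open>v\<close> by \<open>Sup L\<close>.\<close>
    define h' where "h' = (\<lambda>x. h x + (Sup L - h v) * g x)"
    have lin: "linear h'"
      unfolding h'_def using h(1) g(1)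
      by (auto intro!: linearI simp: linear_add linear_scale algebra_simps)
    have hW: "h' w = h w" if "w \<in> W" for w
      using g(2) that by (simp add: h'_def)
    have hv: "h' v = Sup L"
      by (simp add: h'_def g)
    have "h' x \<ge> 0" if x: "x \<in> P" "x \<in> span (insert e (insert v B))" for x
    proof -
      obtain k where k: "x - k *\<^sub>R v \<in> W"
        using x(2) unfolding W' W_def by (auto simp: real_vector.span_breakdown_eq)
      define w where "w = x - k *\<^sub>R v"
      have hx: "h' x = k * Sup L + h w"
      proof -
        have "h' x = h' (k *\<^sub>R v + w)"
          by (simp add: w_def)
        also have "\<dots> = k * h' v + h' w"
          by (simp add: lin linear_add linear_scale)
        finally show ?thesis
          using hv hW k by (simp add: w_def)
      qed
      \<comment> \<open>For nonzero \<open>k\<close>, division by the absolute value of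
        \<open>k\<close> turns \<open>x\<close> into a point \<open>v + w'\<close> or
        \<open>- v + w'\<close> of \<open>P\<close> with \<open>w'\<close> in \<open>W\<close>, to
        which one of the two kinds of bounds applies.\<close>
      consider "k = 0" | "k > 0" | "k < 0"
        by linarith
      then show ?thesis
      proof cases
        case 1
        then show ?thesis
          using hx h(3) x k by (simp add: w_def)
      next
        case 2
        have "(1 / k) *\<^sub>R x \<in> P"
          using 2 x by (intro convex_cone_scaleR[OF P]) auto
        moreover have "(1 / k) *\<^sub>R x = v + (1 / k) *\<^sub>R w"
          using 2 by (simp add: w_def algebra_simps)
        ultimately have "- h ((1 / k) *\<^sub>R w) \<in> L"
          using k W by (auto simp: L_def w_def subspace_scale)
        then have "- h ((1 / k) *\<^sub>R w) \<le> Sup L"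
          using bdd by (rule cSup_upper)
        then show ?thesis
          using 2 hx h(1) by (simp add: linear_scale field_simps)
      next
        case 3
        have "(- 1 / k) *\<^sub>R x \<in> P"
          using 3 x by (intro convex_cone_scaleR[OF P]) (auto simp: field_simps)
        moreover have "(- 1 / k) *\<^sub>R x = - v + (- 1 / k) *\<^sub>R w"
          using 3 by (simp add: w_def algebra_simps)
        moreover have "(- 1 / k) *\<^sub>R w \<in> W"
          using k W unfolding w_def by (rule subspace_scale[rotated])
        ultimately have "Sup L \<le> h ((- 1 / k) *\<^sub>R w)"
          using upper by (intro cSup_least[OF ne]) metis
        then show ?thesis
          using 3 hx h(1) by (simp add: linear_scale linear_neg field_simps)
      qed
    qed
    moreover have "h' e = 1"
      using hW[OF eW[of 1]] h(2) by simp
    ultimately show ?thesis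
      using lin by blast
  qed
qed

lemma sum_in_convex_cone:
  assumes "convex_cone P" and "\<And>i. i \<in> I \<Longrightarrow> f i \<in> P"
  shows "sum f I \<in> P"
  using assms(2)
  by (induction I rule: infinite_finite_induct)
    (auto simp: convex_cone_contains_0 convex_cone_add assms(1))

text \<open>If \<open>P\<close> does not span \<open>S\<close>, a functional vanishing on
  \<open>span P\<close> but not on \<open>S\<close> suffices. Otherwise \<open>P\<close> contains a
  basis of its span, which supplies the order unit for \<open>riesz_extension\<close>.\<close>

lemma supporting_functional_of_proper_cone:
  fixes P S :: "'a::real_vector set"
  assumes findim: "\<exists>B :: 'a set. finite B \<and> span B = UNIV"
    and P: "convex_cone P" and "subspace S" and "P \<subset> S"
  obtains h :: "'a \<Rightarrow> real" and v where "linear h" "\<And>x. x \<in> P \<Longrightarrow> h x \<ge> 0" "v \<in> S" "h v \<noteq> 0"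
proof (cases "S \<subseteq> span P")
  case False
  then obtain v where v: "v \<in> S" "v \<notin> span P"
    by blast
  obtain h :: "'a \<Rightarrow> real" where "linear h" "\<And>x. x \<in> span P \<Longrightarrow> h x = 0" "h v = 1"
    using functional_vanishing_on_subspace[OF subspace_span v(2)] by blast
  then show thesis
    using that[of h v] v by (simp add: span_base)
next
  case True
  obtain B where B: "B \<subseteq> P" "independent B" "P \<subseteq> span B"
    using real_vector.maximal_independent_subset[of P] by blast
  obtain B0 :: "'a set" where B0: "finite B0" "span B0 = UNIV"
    using findim by blast
  have "finite B"
    using real_vector.independent_span_bound[OF B0(1) B(2)] B0(2) by simp
  \<comment> \<open>The sum of a basis contained in \<open>P\<close> is an order unit; \<open>- e\<close> cannot lie in the proper cone \<open>P\<close>.\<close>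
  define e where "e = \<Sum>B"
  have eP: "e \<in> P"
    unfolding e_def by (rule sum_in_convex_cone[OF P]) (use B in auto)
  have unit: "\<exists>t\<ge>0. t *\<^sub>R e + x \<in> P" if "x \<in> span B" for x
  proof -
    obtain u where u: "x = (\<Sum>b\<in>B. u b *\<^sub>R b)"
      using \<open>x \<in> span B\<close> unfolding real_vector.span_finite[OF \<open>finite B\<close>] by (elim rangeE)
    \<comment> \<open>This \<open>t\<close> outweighs every negative coefficient of
      \<open>x\<close>, so all coefficients \<open>t + u b\<close> are nonnegative.\<close>
    define t where "t = (\<Sum>b\<in>B. \<bar>u b\<bar>)"
    have "t *\<^sub>R e + x = (\<Sum>b\<in>B. (t + u b) *\<^sub>R b)"
      by (simp add: u e_def scaleR_sum_right sum.distrib scaleR_left_distrib)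
    moreover have "t + u b \<ge> 0" if "b \<in> B" for b
      using member_le_sum[OF that, of "\<lambda>b. \<bar>u b\<bar>"] \<open>finite B\<close> by (auto simp: t_def)
    ultimately have "t *\<^sub>R e + x \<in> P"
      using B(1) by (auto intro!: sum_in_convex_cone[OF P] convex_cone_scaleR[OF P])
    moreover have "t \<ge> 0"
      by (simp add: t_def sum_nonneg)
    ultimately show ?thesis
      by blast
  qed
  have SB: "S \<subseteq> span B"
    using True B(3) span_minimal subspace_span by blast
  have eB: "span (insert e B) = span B"
    using eP B(3) by (intro span_redundant) auto
  have "- e \<notin> P"
  proof
    assume ne: "- e \<in> P"
    have "x \<in> P" if x: "x \<in> S" for x
    proof -
      obtain t where t: "t \<ge> 0" "t *\<^sub>R e + x \<in> P"
        using unit SB x by blast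
      have "t *\<^sub>R (- e) + (t *\<^sub>R e + x) \<in> P"
        using convex_cone_add[OF P convex_cone_scaleR[OF P t(1) ne] t(2)] .
      then show ?thesis
        by simp
    qed
    then show False
      using \<open>P \<subset> S\<close> by blast
  qed
  then obtain h :: "'a \<Rightarrow> real" where h: "linear h" "h e = 1" "\<forall>x\<in>P \<inter> span (insert e B). h x \<ge> 0"
    using riesz_extension[OF P \<open>- e \<notin> P\<close> \<open>finite B\<close>] unit eB by auto
  show thesis
    using that[of h e] h eP \<open>P \<subset> S\<close> B(3) eB by auto
qed


section \<open>Oriented affine maps\<close>

lemma affine_mapD: "affine_map f \<Longrightarrow> u + v = 1 \<Longrightarrow> f (u *\<^sub>R x + v *\<^sub>R y) = u *\<^sub>R f x + v *\<^sub>R f y"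
  by (simp add: affine_map_def)

lemma affine_map_diff:
  assumes "affine_map f"
  shows "f ((1 + t) *\<^sub>R x - t *\<^sub>R y) = (1 + t) *\<^sub>R f x - t *\<^sub>R f y"
  using affine_mapD[OF assms, of "1 + t" "- t" x y] by simp

text \<open>Combinations with the origin give homogeneity. Additivity then follows because
  \<open>x + y\<close> is the midpoint of \<open>2 x\<close> and \<open>2 y\<close>.\<close>

lemma affine_map_linear_part:
  assumes "affine_map f"
  shows "linear (\<lambda>x. f x - f 0)"
proof (rule linearI)
  have scale: "f (c *\<^sub>R x) - f 0 = c *\<^sub>R (f x - f 0)" for c x
    using affine_mapD[OF assms, of c "1 - c" x 0] by (simp add: algebra_simps)
  then show "f (c *\<^sub>R x) - f 0 = c *\<^sub>R (f x - f 0)" for c x .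
  show "f (x + y) - f 0 = (f x - f 0) + (f y - f 0)" for x y
  proof -
    have twice: "(1/2) *\<^sub>R (f (2 *\<^sub>R x) - f 0) = f x - f 0" for x
      using scale[of 2 x] by simp
    have "f 0 = (1/2) *\<^sub>R f 0 + (1/2) *\<^sub>R f 0"
      by (simp flip: scaleR_left_distrib)
    then have "f (x + y) - f 0 = (1/2) *\<^sub>R (f (2 *\<^sub>R x) - f 0) + (1/2) *\<^sub>R (f (2 *\<^sub>R y) - f 0)"
      using affine_mapD[OF assms, of "1/2" "1/2" "2 *\<^sub>R x" "2 *\<^sub>R y"]
      by (simp add: scaleR_diff_right algebra_simps)
    then show ?thesis
      by (simp only: twice)
  qed
qed

lemma linear_plus_const_affine_map:
  assumes "linear h"
  shows "affine_map (\<lambda>x. h x + c)"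
proof -
  have "c = u *\<^sub>R c + v *\<^sub>R c" if "u + v = 1" for u v :: real
    using that by (metis scaleR_left_distrib scaleR_one)
  then show ?thesis
    using assms by (auto simp: affine_map_def linear_add linear_scale algebra_simps)
qed

section \<open>Pointed cones, lexicographic products and transport\<close>

lemma pointed_iff: "pointed K \<longleftrightarrow> 0 \<in> K \<and> (\<forall>y. y \<in> K \<and> - y \<in> K \<longrightarrow> y = 0)"
proof -
  have "y \<in> uminus ` K \<longleftrightarrow> - y \<in> K" for y
    by (metis add.inverse_inverse imageE imageI)
  then have "lin K = {y \<in> K. - y \<in> K}"
    by (auto simp: lin_def)
  then show ?thesis
    unfolding pointed_def by (auto simp: set_eq_iff)
qed

lemma oriented_functional_oriented_affine:
  "oriented_affine (oriented_functional g) \<longleftrightarrow> affine_map g"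
  by (auto simp: oriented_affine_def oriented_functional_def convex_cone_iff pointed_iff)

lemma oriented_affineD:
  assumes "oriented_affine f"
  shows "subspace (target f)" "affine_map (omap f)" "omap f x \<in> target f" "pos f \<subseteq> target f"
    "convex_cone (pos f)" "y \<in> pos f \<Longrightarrow> - y \<in> pos f \<Longrightarrow> y = 0"
  using assms by (auto simp: oriented_affine_def pointed_iff)

lemma lex_product_oriented_affine:
  assumes f: "oriented_affine f" and g: "oriented_affine g"
  shows "oriented_affine (f \<rtimes> g)"
proof -
  note F = oriented_affineD[OF f] and G = oriented_affineD[OF g]
  \<comment> \<open>Pointedness prevents a nonzero first component from being cancelled in a sum, so
    such a sum stays in the part of the cone where the second component is free.\<close>
  have add0: "a + b \<noteq> 0" if "a \<in> pos f" "b \<in> pos f" "a \<noteq> 0" for a b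
    using F(6)[of a] that by (metis add_eq_0_iff)
  have "convex_cone (pos (f \<rtimes> g))"
    unfolding convex_cone_iff
  proof (intro conjI ballI allI impI)
    show "0 \<in> pos (f \<rtimes> g)"
      using G(5) by (auto simp: lex_product_def zero_prod_def convex_cone_contains_0)
  next
    fix p q assume "p \<in> pos (f \<rtimes> g)" "q \<in> pos (f \<rtimes> g)"
    then show "p + q \<in> pos (f \<rtimes> g)"
      using F(5) G(1,4,5) add0
      by (auto simp: lex_product_def convex_cone_add subspace_add subset_iff)
  next
    fix p and c :: real assume "p \<in> pos (f \<rtimes> g)" "0 \<le> c"
    then show "c *\<^sub>R p \<in> pos (f \<rtimes> g)"
      using F(5) G(1,5)
      \<comment> \<open>Scaling by 0 moves a pair with nonzero first component into the other part
        of the cone.\<close>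
      by (cases "c = 0")
        (auto simp: lex_product_def zero_prod_def convex_cone_contains_0 convex_cone_scaleR subspace_scale)
  qed
  moreover have "pointed (pos (f \<rtimes> g))"
    using F(6) G(5,6) by (auto simp: pointed_iff lex_product_def zero_prod_def convex_cone_contains_0)
  moreover have "affine_map (omap (f \<rtimes> g))"
    using F(2) G(2) by (simp add: affine_map_def lex_product_def)
  moreover have "subspace (target (f \<rtimes> g))"
    using F(1) G(1) by (simp add: lex_product_def subspace_Times)
  moreover have "pos (f \<rtimes> g) \<subseteq> target (f \<rtimes> g)"
    using F(1,4) G(4) by (auto simp: lex_product_def subspace_0)
  moreover have "range (omap (f \<rtimes> g)) \<subseteq> target (f \<rtimes> g)"
    using F(3) G(3) by (auto simp: lex_product_def)
  ultimately show ?thesis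
    by (simp add: oriented_affine_def)
qed

lemma transport_oriented_affine:
  assumes f: "oriented_affine f" and j: "linear j" and inj: "inj_on j (target f)"
  shows "oriented_affine (transport j f)"
proof -
  note F = oriented_affineD[OF f]
  have "pointed (j ` pos f)"
    unfolding pointed_iff
  proof (intro conjI allI impI)
    show "0 \<in> j ` pos f"
      using linear_0[OF j] convex_cone_contains_0[OF F(5)] by (metis imageI)
  next
    fix y assume "y \<in> j ` pos f \<and> - y \<in> j ` pos f"
    then obtain a b where ab: "a \<in> pos f" "b \<in> pos f" "y = j a" "- y = j b"
      by blast
    then have "j b = j (- a)"
      by (simp add: linear_neg j)
    \<comment> \<open>Injectivity is known only on the target, so \<open>- a\<close> must first be
      placed there.\<close>
    moreover have "- a \<in> target f" "b \<in> target f"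
      using ab F(1,4) by (auto simp: subspace_neg)
    ultimately have "b = - a"
      using inj by (simp add: inj_on_eq_iff)
    then have "a = 0"
      using ab F(6) by simp
    then show "y = 0"
      using ab j by (simp add: linear_0)
  qed
  moreover have "affine_map (j \<circ> omap f)"
    using F(2) j by (simp add: affine_map_def linear_add linear_scale)
  moreover have "convex_cone (j ` pos f)"
    using F(5) j convex_cone_linear_image by blast
  ultimately show ?thesis
    using F(1,3,4) j
    by (auto simp: oriented_affine_def transport_def linear_subspace_image)
qed

lemma transport_separates:
  assumes "linear j" and "separates f C D"
  shows "separates (transport j f) C D"
proof -
  have "- j y \<in> j ` pos f" if "- y \<in> pos f" for y
    using that by (metis assms(1) imageI linear_neg)
  then show ?thesis
    using assms(2) by (auto simp: separates_def transport_def ole_def)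
qed

lemma initial_map_oriented_affine: "oriented_affine initial_map"
  by (auto simp: oriented_affine_def initial_map_def affine_map_def convex_cone_iff pointed_iff subspace_def)


section \<open>Existence of the next functional\<close>

text \<open>Separation makes both \<open>f c\<close> and \<open>- f d\<close> positive or zero. If
  \<open>f d < f c\<close> fails, the two values coincide, and pointedness makes the common value
  0.\<close>

lemma not_certifies_disjointE:
  assumes f: "oriented_affine f" and sep: "separates f C D" and "\<not> certifies_disjoint f C D"
  obtains c d where "c \<in> C" "d \<in> D" "omap f c = 0" "omap f d = 0"
proof -
  note F = oriented_affineD[OF f]
  have pos: "omap f c \<in> pos f" "- omap f d \<in> pos f" if "c \<in> C" "d \<in> D" for c d
    using sep that by (auto simp: separates_def ole_def)
  obtain c d where cd: "c \<in> C" "d \<in> D" "\<not> oless f (omap f d) (omap f c)"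
    using assms(3) by (auto simp: certifies_disjoint_def)
  have "omap f c - omap f d \<in> pos f"
    using convex_cone_add[OF F(5) pos[OF cd(1,2)]] by simp
  then have "omap f c = omap f d"
    using cd(3) by (auto simp: oless_def ole_def)
  then have "omap f c = 0"
    using F(6) pos[OF cd(1,2)] by metis
  then show thesis
    using that cd \<open>omap f c = omap f d\<close> by simp
qed

text \<open>Elements of \<open>K - G\<close> have the form \<open>(s c - t d, s - t)\<close>; height
  1 forces \<open>s = 1 + t\<close> and height -1 forces \<open>t = 1 + s\<close>. Geometrically,
  \<open>x\<close> lies on a ray from a point of \<open>D\<close> through a point of
  \<open>C\<close>, at or beyond the latter, and likewise with the roles exchanged.\<close>

lemma joint_supporting_subspace_iff:
  assumes "C \<noteq> {}" and "D \<noteq> {}"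
  shows "x \<in> joint_supporting_subspace C D \<longleftrightarrow>
    (\<exists>c\<in>C. \<exists>d\<in>D. \<exists>t\<ge>0. x = (1 + t) *\<^sub>R c - t *\<^sub>R d) \<and>
    (\<exists>c\<in>C. \<exists>d\<in>D. \<exists>t\<ge>0. x = (1 + t) *\<^sub>R d - t *\<^sub>R c)"
proof -
  have cone: "gen_cone (S \<times> {1::real}) = {(t *\<^sub>R s, t) | t s. t \<ge> 0 \<and> s \<in> S}" if "S \<noteq> {}" for S :: "'a set"
  proof -
    have "(0, 0) \<in> {(t *\<^sub>R s, t) | t s. t \<ge> (0::real) \<and> s \<in> S}"
      using that by force
    then show ?thesis
      by (auto simp: gen_cone_def zero_prod_def)
  qed
  define M where "M = {k - g | k g. k \<in> gen_cone (C \<times> {1::real}) \<and> g \<in> gen_cone (D \<times> {1::real})}"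
  have M: "(y, r) \<in> M \<longleftrightarrow> (\<exists>c\<in>C. \<exists>d\<in>D. \<exists>s\<ge>0. \<exists>t\<ge>0. y = s *\<^sub>R c - t *\<^sub>R d \<and> r = s - t)" for y r
    unfolding M_def cone[OF assms(1)] cone[OF assms(2)] by auto blast
  have pos: "(x, 1) \<in> M \<longleftrightarrow> (\<exists>c\<in>C. \<exists>d\<in>D. \<exists>t\<ge>0. x = (1 + t) *\<^sub>R c - t *\<^sub>R d)"
  proof
    assume "(x, 1) \<in> M"
    then obtain c d s t where h: "c \<in> C" "d \<in> D" "t \<ge> 0" "x = s *\<^sub>R c - t *\<^sub>R d" "1 = s - t"
      unfolding M by blast
    then have "s = 1 + t"
      by simp
    then show "\<exists>c\<in>C. \<exists>d\<in>D. \<exists>t\<ge>0. x = (1 + t) *\<^sub>R c - t *\<^sub>R d"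
      using h by blast
  next
    assume "\<exists>c\<in>C. \<exists>d\<in>D. \<exists>t\<ge>0. x = (1 + t) *\<^sub>R c - t *\<^sub>R d"
    then obtain c d t where h: "c \<in> C" "d \<in> D" "t \<ge> 0" "x = (1 + t) *\<^sub>R c - t *\<^sub>R d"
      by blast
    then show "(x, 1) \<in> M"
      unfolding M by (intro bexI[of _ c] bexI[of _ d] exI[of _ "1 + t"] exI[of _ t] conjI) auto
  qed
  have neg: "(- x, - 1) \<in> M \<longleftrightarrow> (\<exists>c\<in>C. \<exists>d\<in>D. \<exists>t\<ge>0. x = (1 + t) *\<^sub>R d - t *\<^sub>R c)"
  proof
    assume "(- x, - 1) \<in> M"
    then obtain c d s t where h: "c \<in> C" "d \<in> D" "s \<ge> 0" "- x = s *\<^sub>R c - t *\<^sub>R d" "- 1 = s - t"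
      unfolding M by blast
    then have "t = 1 + s"
      by simp
    moreover have "x = t *\<^sub>R d - s *\<^sub>R c"
      using h(4) by (metis minus_diff_eq minus_minus)
    ultimately show "\<exists>c\<in>C. \<exists>d\<in>D. \<exists>t\<ge>0. x = (1 + t) *\<^sub>R d - t *\<^sub>R c"
      using h by blast
  next
    assume "\<exists>c\<in>C. \<exists>d\<in>D. \<exists>t\<ge>0. x = (1 + t) *\<^sub>R d - t *\<^sub>R c"
    then obtain c d t where h: "c \<in> C" "d \<in> D" "t \<ge> 0" "x = (1 + t) *\<^sub>R d - t *\<^sub>R c"
      by blast
    then show "(- x, - 1) \<in> M"
      unfolding M by (intro bexI[of _ c] bexI[of _ d] exI[of _ t] exI[of _ "1 + t"] conjI) auto
  qed
  have "x \<in> joint_supporting_subspace C D \<longleftrightarrow> (x, 1) \<in> M \<and> (x, 1) \<in> uminus ` M"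
    by (simp add: joint_supporting_subspace_def Let_def lin_def M_def)
  also have "(x, 1) \<in> uminus ` M \<longleftrightarrow> (- x, - 1) \<in> M"
    by (force simp: image_iff)
  finally show ?thesis
    using pos neg by simp
qed

text \<open>The two representations of \<open>x\<close> write \<open>f x\<close> and
  \<open>- f x\<close> as nonnegative combinations of values \<open>f c\<close> and
  \<open>- f d\<close>, so both lie in the pointed cone.\<close>

lemma joint_supporting_subspace_subset_ker:
  assumes f: "oriented_affine f" and sep: "separates f C D" and "C \<noteq> {}" "D \<noteq> {}"
  shows "joint_supporting_subspace C D \<subseteq> ker f"
proof
  fix x assume "x \<in> joint_supporting_subspace C D"
  then obtain c d t c' d' t' where
    x: "c \<in> C" "d \<in> D" "t \<ge> 0" "x = (1 + t) *\<^sub>R c - t *\<^sub>R d"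
    and x': "c' \<in> C" "d' \<in> D" "t' \<ge> 0" "x = (1 + t') *\<^sub>R d' - t' *\<^sub>R c'"
    unfolding joint_supporting_subspace_iff[OF assms(3,4)] by blast
  note F = oriented_affineD[OF f]
  have pos: "omap f c \<in> pos f" "- omap f d \<in> pos f" if "c \<in> C" "d \<in> D" for c d
    using sep that by (auto simp: separates_def ole_def)
  have "omap f x = (1 + t) *\<^sub>R omap f c + t *\<^sub>R (- omap f d)"
    using affine_map_diff[OF F(2)] x(4) by simp
  also have "\<dots> \<in> pos f"
    using x pos by (intro convex_cone_add[OF F(5)] convex_cone_scaleR[OF F(5)]) auto
  finally have p: "omap f x \<in> pos f" .
  have "- omap f x = (1 + t') *\<^sub>R (- omap f d') + t' *\<^sub>R omap f c'"
    using affine_map_diff[OF F(2)] x'(4) by simp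
  also have "\<dots> \<in> pos f"
    using x' pos by (intro convex_cone_add[OF F(5)] convex_cone_scaleR[OF F(5)]) auto
  finally show "x \<in> ker f"
    using p F(6) by (simp add: ker_def)
qed

section \<open>The cone of differences inside the kernel\<close>

lemma convex_cone_gen_cone:
  assumes "convex S"
  shows "convex_cone (gen_cone S)"
proof (cases "S = {}")
  case True
  then show ?thesis
    by (simp add: gen_cone_def convex_cone_iff)
next
  case False
  then have "0 \<in> cone hull S"
    using cone_contains_0[OF cone_cone_hull, of S] by (simp add: cone_hull_empty_iff[symmetric])
  then have "gen_cone S = cone hull S"
    unfolding gen_cone_def cone_hull_expl by (rule insert_absorb)
  moreover have "convex (cone hull S) \<and> cone (cone hull S)"
    by (simp add: convex_cone_hull[OF assms] cone_cone_hull)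
  ultimately show ?thesis
    using \<open>0 \<in> cone hull S\<close> unfolding convex_cone convex_cone_iff by simp
qed

lemma convex_Int_ker:
  assumes "affine_map (omap f)" and "convex C"
  shows "convex (C \<inter> ker f)"
  using assms by (auto simp: convex_def ker_def affine_map_def)

text \<open>If every direction of the kernel is a nonnegative multiple of some \<open>c - d\<close>, then all kernel
  points lie beyond \<open>C\<close> as seen from \<open>D\<close> and vice versa, that is, in the joint supporting subspace.\<close>

lemma ker_subset_joint_supporting_subspace:
  assumes f: "affine_map (omap f)" and "convex C" "convex D"
    and c0: "c0 \<in> C \<inter> ker f" and d0: "d0 \<in> D \<inter> ker f"
    and full: "\<And>v. omap f v = omap f 0 \<Longrightarrow>
      v \<in> gen_cone {c - d | c d. c \<in> C \<inter> ker f \<and> d \<in> D \<inter> ker f}"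
  shows "ker f \<subseteq> joint_supporting_subspace C D"
proof
  note linf = affine_map_linear_part[OF f]
  have cone: "\<exists>c\<in>C. \<exists>d\<in>D. \<exists>s\<ge>0. x - y = s *\<^sub>R (c - d)" if "x \<in> ker f" "y \<in> ker f" for x y
  proof -
    have "omap f (x - y) = omap f 0"
      using linear_diff[OF linf, of x y] that by (simp add: ker_def)
    then have "x - y = 0 \<or> (\<exists>s c d. x - y = s *\<^sub>R (c - d) \<and> s \<ge> 0 \<and> c \<in> C \<and> d \<in> D)"
      using full unfolding gen_cone_def by blast
    then show ?thesis
    proof
      assume "x - y = 0"
      then have "x - y = 0 *\<^sub>R (c0 - d0)"
        by simp
      then show ?thesis
        using c0 d0 by blast
    qed blast
  qed
  \<comment> \<open>Normalising by \<open>1 + s\<close> merges the base point and the moving point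
    into a single point of the convex set.\<close>
  have absorb: "\<exists>a\<in>A. z + s *\<^sub>R b = (1 + s) *\<^sub>R a"
    if "convex A" "z \<in> A" "b \<in> A" "s \<ge> 0" for z b s and A :: "'a set"
  proof
    show "(1 / (1 + s)) *\<^sub>R z + (s / (1 + s)) *\<^sub>R b \<in> A"
      using that by (intro convexD) (auto simp: add_divide_distrib[symmetric])
    show "z + s *\<^sub>R b = (1 + s) *\<^sub>R ((1 / (1 + s)) *\<^sub>R z + (s / (1 + s)) *\<^sub>R b)"
      using \<open>s \<ge> 0\<close> by (simp add: scaleR_add_right)
  qed
  fix x assume x: "x \<in> ker f"
  obtain c d s where s: "c \<in> C" "d \<in> D" "s \<ge> 0" "x - c0 = s *\<^sub>R (c - d)"
    using cone[OF x] c0 by blast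
  then have "x = c0 + s *\<^sub>R c - s *\<^sub>R d"
    by (simp add: algebra_simps)
  moreover obtain a where "a \<in> C" "c0 + s *\<^sub>R c = (1 + s) *\<^sub>R a"
    using absorb[OF \<open>convex C\<close> _ s(1,3)] c0 by blast
  ultimately have 1: "\<exists>c\<in>C. \<exists>d\<in>D. \<exists>t\<ge>0. x = (1 + t) *\<^sub>R c - t *\<^sub>R d"
    using s by auto
  \<comment> \<open>The same argument for the reversed direction \<open>d0 - x\<close> starts at
    \<open>d0\<close> and places \<open>x\<close> beyond \<open>D\<close>.\<close>
  obtain c' d' s' where s': "c' \<in> C" "d' \<in> D" "s' \<ge> 0" "d0 - x = s' *\<^sub>R (c' - d')"
    using cone[OF _ x] d0 by blast
  then have "x = d0 + s' *\<^sub>R d' - s' *\<^sub>R c'"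
    by (simp add: algebra_simps)
  moreover obtain b where "b \<in> D" "d0 + s' *\<^sub>R d' = (1 + s') *\<^sub>R b"
    using absorb[OF \<open>convex D\<close> _ s'(2,3)] d0 by blast
  ultimately have 2: "\<exists>c\<in>C. \<exists>d\<in>D. \<exists>t\<ge>0. x = (1 + t) *\<^sub>R d - t *\<^sub>R c"
    using s' by auto
  have "C \<noteq> {}" "D \<noteq> {}"
    using c0 d0 by auto
  then show "x \<in> joint_supporting_subspace C D"
    using 1 2 by (simp add: joint_supporting_subspace_iff)
qed

lemma exists_admissible:
  fixes C D :: "'a::real_vector set" and f :: "('a, 'b::real_vector) oriented_map"
  assumes findim: "\<exists>B :: 'a set. finite B \<and> span B = UNIV"
    and "convex C" and "convex D"
    and f: "oriented_affine f" and sep: "separates f C D" and "\<not> finished C D f"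
  shows "\<exists>g. admissible C D f g"
proof -
  note F = oriented_affineD[OF f]
  note linf = affine_map_linear_part[OF F(2)]
  have "\<not> certifies_disjoint f C D" and ker_ne: "ker f \<noteq> joint_supporting_subspace C D"
    using \<open>\<not> finished C D f\<close> by (auto simp: finished_def)
  then obtain c0 d0 where c0: "c0 \<in> C \<inter> ker f" and d0: "d0 \<in> D \<inter> ker f"
    by (elim not_certifies_disjointE[OF f sep]) (auto simp: ker_def)
  define Z where "Z = {c - d | c d. c \<in> C \<inter> ker f \<and> d \<in> D \<inter> ker f}"
  have "convex (\<Union>x\<in>C \<inter> ker f. \<Union>y\<in>D \<inter> ker f. {x - y})"
    using F(2) assms(2,3) by (intro convex_differences convex_Int_ker)
  also have "(\<Union>x\<in>C \<inter> ker f. \<Union>y\<in>D \<inter> ker f. {x - y}) = Z"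
    by (auto simp: Z_def)
  finally have coneZ: "convex_cone (gen_cone Z)"
    by (rule convex_cone_gen_cone)
  \<comment> \<open>\<open>S\<close> is the null space of the linear part of \<open>f\<close>, hence
    the direction space of the kernel.\<close>
  define S where "S = {v. omap f v = omap f 0}"
  have subS: "subspace S"
    using linear_subspace_kernel[OF linf] by (simp add: S_def)
  have "c - d \<in> S" if "c \<in> ker f" "d \<in> ker f" for c d
    using linear_diff[OF linf, of c d] that by (simp add: S_def ker_def)
  then have "Z \<subseteq> S"
    by (auto simp: Z_def)
  then have "gen_cone Z \<subseteq> S"
    using subS by (auto simp: gen_cone_def subspace_0 subspace_scale subset_iff)
  moreover have "gen_cone Z \<noteq> S"
  proof
    assume "gen_cone Z = S"
    then have "ker f \<subseteq> joint_supporting_subspace C D"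
      using ker_subset_joint_supporting_subspace[OF F(2) assms(2,3) c0 d0]
      unfolding Z_def S_def by blast
    moreover have "joint_supporting_subspace C D \<subseteq> ker f"
      using joint_supporting_subspace_subset_ker[OF f sep] c0 d0 by blast
    ultimately show False
      using ker_ne by blast
  qed
  ultimately obtain h :: "'a \<Rightarrow> real" and v
    where h: "linear h" "\<And>x. x \<in> gen_cone Z \<Longrightarrow> h x \<ge> 0" "v \<in> S" "h v \<noteq> 0"
    using supporting_functional_of_proper_cone[OF findim coneZ subS] by blast
  have le: "h d \<le> h c" if "c \<in> C \<inter> ker f" "d \<in> D \<inter> ker f" for c d
  proof -
    have "1 *\<^sub>R (c - d) \<in> gen_cone Z"
      unfolding gen_cone_def Z_def using that zero_le_one by blast
    then have "h (c - d) \<ge> 0"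
      using h(2) by simp
    then show ?thesis
      using h(1) by (simp add: linear_diff)
  qed
  \<comment> \<open>On the kernel, \<open>h\<close> is at most as large on \<open>D\<close> as on
    \<open>C\<close>. Subtracting the infimum over \<open>C\<close> puts 0 between the two sets of
    values; \<open>h d0\<close> shows that the infimum is finite.\<close>
  define g where "g = (\<lambda>x. h x - Inf (h ` (C \<inter> ker f)))"
  have gD: "g d \<le> 0" if "d \<in> D" "omap f d = 0" for d
    using that c0 le cInf_greatest[of "h ` (C \<inter> ker f)" "h d"] by (auto simp: g_def ker_def)
  have "bdd_below (h ` (C \<inter> ker f))"
    using le[OF _ d0] by (intro bdd_belowI[of _ "h d0"]) auto
  then have gC: "g c \<ge> 0" if "c \<in> C" "omap f c = 0" for c
    using that cInf_lower[of "h c" "h ` (C \<inter> ker f)"] by (auto simp: g_def ker_def)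
  have "affine_map g"
    using linear_plus_const_affine_map[OF h(1), of "- Inf (h ` (C \<inter> ker f))"] by (simp add: g_def)
  moreover have "\<not> g constant_on ker f"
  proof
    assume "g constant_on ker f"
    moreover have "c0 + v \<in> ker f"
      using linear_add[OF linf, of c0 v] c0 h(3) by (simp add: S_def ker_def)
    ultimately have "g (c0 + v) = g c0"
      using c0 unfolding constant_on_def by auto
    then show False
      using h(1,4) by (simp add: g_def linear_add)
  qed
  \<comment> \<open>Only points of the kernel constrain \<open>g\<close>: where \<open>f\<close> is
    nonzero, the lexicographic cone leaves the second component free.\<close>
  moreover have "separates (f \<rtimes> oriented_functional g) C D"
    using sep gC gD
    by (auto simp: separates_def ole_def lex_product_def oriented_functional_def zero_prod_def)
  ultimately have "admissible C D f g"
    by (simp add: admissible_def oriented_functional_oriented_affine)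
  then show ?thesis
    by blast
qed


section \<open>Termination\<close>

text \<open>Separation by the product is part of \<open>admissible\<close>; what remains is to carry
  it and the pointed cone structure along the isomorphism \<open>append_coord\<close>.\<close>

lemma loop_reaches_invariant:
  assumes "loop_reaches C D m f"
  shows "oriented_affine f \<and> separates f C D"
  using assms
proof (induction rule: loop_reaches.induct)
  case start
  then show ?case
    by (simp add: initial_map_oriented_affine) (simp add: initial_map_def separates_def ole_def)
next
  case (step m f f')
  then obtain g where g: "admissible C D f g"
    and f': "f' = transport (append_coord (Suc m)) (f \<rtimes> oriented_functional g)"
    by (auto simp: loop_step_def)
  note iso = append_coord_iso[OF step.hyps(1)]
  have "inj_on (append_coord (Suc m)) (target (f \<rtimes> oriented_functional g))"
    using iso(2) by (simp add: bij_betw_def lex_product_def oriented_functional_def)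
  moreover have "oriented_affine (f \<rtimes> oriented_functional g)"
    using step.IH g by (simp add: lex_product_oriented_affine admissible_def)
  ultimately have "oriented_affine f'"
    unfolding f' using iso(1) by (rule transport_oriented_affine[rotated 2])
  moreover have "separates f' C D"
    unfolding f' using iso(1) g by (simp add: transport_separates admissible_def)
  ultimately show ?case
    by simp
qed

text \<open>The condition on \<open>span B\<close> says that it meets the null space of the linear part of \<open>f\<close> trivially.
  Working with the linear part keeps the count valid even when \<open>ker f\<close> is empty.\<close>

lemma loop_reaches_independent:
  fixes C D :: "'a::real_vector set"
  assumes "loop_reaches C D m f"
  shows "\<exists>B. independent B \<and> finite B \<and> card B = m \<and> (\<forall>v\<in>span B. omap f v = omap f 0 \<longrightarrow> v = 0)"
  using assms
proof (induction rule: loop_reaches.induct)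
  case start
  show ?case
    by (rule exI[of _ "{}"]) (simp add: real_vector.independent_empty)
next
  case (step m f f')
  then obtain B g where B: "independent B" "finite B" "card B = m"
      "\<And>v. v \<in> span B \<Longrightarrow> omap f v = omap f 0 \<Longrightarrow> v = 0"
    and g: "admissible C D f g"
    and f': "f' = transport (append_coord (Suc m)) (f \<rtimes> oriented_functional g)"
    by (auto simp: loop_step_def)
  note iso = append_coord_iso[OF step.hyps(1)]
  have F: "oriented_affine f"
    using loop_reaches_invariant step.hyps(1) by blast
  note linf = affine_map_linear_part[OF oriented_affineD(2)[OF F]]
  have ling: "linear (\<lambda>x. g x - g 0)"
    using g by (intro affine_map_linear_part) (simp add: admissible_def oriented_functional_oriented_affine)
  \<comment> \<open>Injectivity of \<open>append_coord\<close> on the product recovers both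
    components from a value of \<open>f'\<close>.\<close>
  have f'_eq: "omap f v = omap f 0 \<and> g v = g 0" if "omap f' v = omap f' 0" for v
    using that inj_onD[OF bij_betw_imp_inj_on[OF iso(2)], of "(omap f v, g v)" "(omap f 0, g 0)"]
      oriented_affineD(3)[OF F]
    by (simp add: f' transport_def lex_product_def oriented_functional_def)
  have "\<exists>x\<in>ker f. \<exists>y\<in>ker f. g x \<noteq> g y"
    using g unfolding admissible_def constant_on_def by metis
  then obtain x y where xy: "omap f x = 0" "omap f y = 0" "g x \<noteq> g y"
    by (auto simp: ker_def)
  \<comment> \<open>A direction of \<open>ker f\<close> along which \<open>g\<close> changes. The
    linear part of \<open>f\<close> kills it, so it lies outside \<open>span B\<close> and can
    enlarge \<open>B\<close>.\<close>
  define v where "v = x - y"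
  have fv: "omap f v = omap f 0"
    using linear_diff[OF linf, of x y] xy by (simp add: v_def)
  have gv: "g v \<noteq> g 0"
    using linear_diff[OF ling, of x y] xy by (simp add: v_def)
  then have "v \<noteq> 0"
    by auto
  then have v: "v \<notin> span B"
    using B(4) fv by blast
  show ?case
  proof (intro exI[of _ "insert v B"] conjI ballI impI)
    show "independent (insert v B)"
      using v B(1) by (rule real_vector.independent_insertI)
    show "card (insert v B) = Suc m"
      using v B span_base by (subst card_insert_disjoint) blast+
  next
    fix w assume w: "w \<in> span (insert v B)" "omap f' w = omap f' 0"
    obtain k where k: "w - k *\<^sub>R v \<in> span B"
      using w(1) by (auto simp: real_vector.span_breakdown_eq)
    have "omap f (w - k *\<^sub>R v) = omap f 0"
      using linear_diff[OF linf, of w "k *\<^sub>R v"] linear_scale[OF linf, of k v] fv f'_eq[OF w(2)] by simp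
    then have "w = k *\<^sub>R v"
      using B(4)[OF k] by simp
    moreover from this have "k * (g v - g 0) = 0"
      using linear_scale[OF ling, of k v] f'_eq[OF w(2)] by simp
    ultimately show "w = 0"
      using gv by simp
  qed (use B in simp)
qed

lemma loop_reaches_le_dim:
  fixes C D :: "'a::real_vector set"
  assumes findim: "\<exists>B :: 'a set. finite B \<and> span B = UNIV" and "loop_reaches C D m f"
  shows "m \<le> dim (UNIV :: 'a set)"
proof -
  obtain B :: "'a set" where B: "independent B" "finite B" "card B = m"
    using loop_reaches_independent[OF assms(2)] by blast
  obtain E where E: "B \<subseteq> E" "independent E" "UNIV \<subseteq> span E"
    using real_vector.maximal_independent_subset_extend[OF subset_UNIV B(1)] by metis
  obtain B0 :: "'a set" where B0: "finite B0" "span B0 = UNIV"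
    using findim by blast
  have "finite E"
    using real_vector.independent_span_bound[OF B0(1) E(2)] B0(2) by simp
  moreover have "dim (UNIV :: 'a set) = card E"
    using E(2,3) by (intro real_vector.dim_eq_card) auto
  ultimately show ?thesis
    using card_mono[OF _ E(1)] B(3) by simp
qed

text \<open>Only the entries before \<open>m\<close> are assumed unfinished, so the lemma also
  applies to the entry that is returned.\<close>

lemma loop_run_reaches:
  assumes "loop_run C D \<Phi>" and "\<And>k. k < m \<Longrightarrow> \<not> finished C D (\<Phi> k)"
  shows "loop_reaches C D m (\<Phi> m)"
  using assms(2)
proof (induction m)
  case 0
  then show ?case
    using assms(1) loop_reaches.start by (simp add: loop_run_def)
next
  case (Suc m)
  then have "loop_step C D (Suc m) (\<Phi> m) (\<Phi> (Suc m))"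
    using assms(1) by (simp add: loop_run_def)
  then show ?case
    using Suc by (intro loop_reaches.step) auto
qed

theorem theorem6p8:
  fixes C D :: "'a::real_vector set"
  assumes findim: "\<exists>B :: 'a set. finite B \<and> span B = UNIV"
    and "convex C" and "convex D"
  shows "(\<forall>m f. loop_reaches C D m f \<and> \<not> finished C D f \<longrightarrow> (\<exists>g. admissible C D f g)) \<and>
         (\<forall>\<Phi>. loop_run C D \<Phi> \<longrightarrow>
            (\<exists>m. m \<le> dim (UNIV :: 'a set) \<and> loop_returns C D \<Phi> m \<and>
                 oriented_affine (\<Phi> m) \<and> separates (\<Phi> m) C D \<and>
                 (certifies_disjoint (\<Phi> m) C D \<or> ker (\<Phi> m) = joint_supporting_subspace C D)))"
proof (intro conjI allI impI)
  fix m f assume "loop_reaches C D m f \<and> \<not> finished C D f"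
  then show "\<exists>g. admissible C D f g"
    using exists_admissible[OF findim \<open>convex C\<close> \<open>convex D\<close>] loop_reaches_invariant by blast
next
  fix \<Phi> assume run: "loop_run C D \<Phi>"
  have "\<exists>m. finished C D (\<Phi> m)"
  proof (rule ccontr)
    assume "\<nexists>m. finished C D (\<Phi> m)"
    \<comment> \<open>A run that never finishes would get one step past the dimension bound.\<close>
    then have "loop_reaches C D (Suc (dim (UNIV :: 'a set))) (\<Phi> (Suc (dim (UNIV :: 'a set))))"
      by (intro loop_run_reaches[OF run]) blast
    then show False
      using loop_reaches_le_dim[OF findim] by fastforce
  qed
  \<comment> \<open>The least finished index is the one at which the loop returns.\<close>
  then obtain m where m: "finished C D (\<Phi> m)" "\<And>k. k < m \<Longrightarrow> \<not> finished C D (\<Phi> k)"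
    using exists_least_iff[of "\<lambda>m. finished C D (\<Phi> m)"] by blast
  then have reach: "loop_reaches C D m (\<Phi> m)"
    by (intro loop_run_reaches[OF run])
  show "\<exists>m. m \<le> dim (UNIV :: 'a set) \<and> loop_returns C D \<Phi> m \<and>
      oriented_affine (\<Phi> m) \<and> separates (\<Phi> m) C D \<and>
      (certifies_disjoint (\<Phi> m) C D \<or> ker (\<Phi> m) = joint_supporting_subspace C D)"
    using m loop_reaches_le_dim[OF findim reach] loop_reaches_invariant[OF reach]
    by (intro exI[of _ m]) (auto simp: loop_returns_def finished_def)
qed

end
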